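(* Let $M$ be a monoid (with identity $1$) such that $E(M)\subseteq Z(M)$, and let $\mu$ be an idempotent monoid homomorphism from $M$ to $E(M)$ such that, for every $x\in M$, $\mu(x)=e_x$ with $e_x\in E(M)$ a right identity for $x$ (i.e., $x\,\mu(x)=x$). Moreover, let $\{\theta_e: M\to M \mid e\in \operatorname{Im}\mu\}$ be a family of maps such that $\theta_1=\mu$ and such that, for every $e\in\operatorname{Im}\mu$, (i) $\theta_e(xy)=\theta_e(x)\,\theta_f(y)$ for all $x,y\in M$, where $f=\mu(ex)$; (ii) $\theta_e=\theta_e\theta_{ef}$ for every $f\in\operatorname{Im}\mu$; (iii) $\theta_{ef}\theta_e(x)=\theta_e(x)$ for every $x\in M$, where $f=\mu(x)$. Then, setting $\theta_x:=\theta_{\mu(x)}$ for every $x\in M$, the map $s:M\times M\to M\times M$ given by $s(x,y)=(xy,\theta_x(y))$ is an idempotent solution on $M$. Conversely, every idempotent solution on $M$ can be so constructed: that is, if $s(x,y)=(xy,\theta_x(y))$ is an idempotent solution on a monoid $M$ with $E(M)\subseteq Z(M)$, then there are an idempotent monoid homomorphism $\mu$ from $M$ to $E(M)$ with $x\,\mu(x)=x$ for every $x\in M$, and a family of maps $\{\theta_e: M\to M\mid e\in\operatorname{Im}\mu\}$ with $\theta_1=\mu$ satisfying, for every $e\in\operatorname{Im}\mu$, $\theta_e(xy)=\theta_e(x)\,\theta_{\mu(ex)}(y)$ for all $x,y\in M$, $\theta_e=\theta_e\theta_{ef}$ for every $f\in\operatorname{Im}\mu$, and $\theta_{e\mu(x)}\theta_e(x)=\theta_e(x)$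 for every $x\in M$, from which $s$ arises by setting $\theta_x=\theta_{\mu(x)}$ for every $x\in M$.
   Context: For a semigroup $X$, a solution (set-theoretical solution of the pentagon equation) on $X$ is a map $s:X\times X\to X\times X$ of the form $s(x,y)=(xy,\theta_x(y))$, where $xy$ is the product in $X$ and $\theta_x:X\to X$ is a map for every $x\in X$, such that for all $x,y,z\in X$: $\theta_x(y)\,\theta_{xy}(z)=\theta_x(yz)$ and $\theta_{\theta_x(y)}\theta_{xy}=\theta_y$. Juxtaposition of maps denotes composition. The solution $s$ is idempotent if $s^2=s$ (composition). $E(M)$ denotes the set of idempotents of $M$ and $Z(M)$ the center of $M$; when $E(M)\subseteq Z(M)$, $E(M)$ is a submonoid of $M$. A map $\mu$ is idempotent if $\mu\mu=\mu$, where a homomorphism from $M$ to $E(M)\subseteq M$ is regarded as a map from $M$ to $M$. *)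

theory Defs
  imports Main
begin

definition idempotents :: "'a::semigroup_mult set" where
  "idempotents = {e. e * e = e}"

definition center :: "'a::semigroup_mult set" where
  "center = {z. \<forall>x. z * x = x * z}"

definition pentagon_solution :: "('a::semigroup_mult \<times> 'a \<Rightarrow> 'a \<times> 'a) \<Rightarrow> bool" where
  "pentagon_solution s \<longleftrightarrow>
     (\<exists>\<theta>. (\<forall>x y. s (x, y) = (x * y, \<theta> x y))
        \<and> (\<forall>x y z. \<theta> x y * \<theta> (x * y) z = \<theta> x (y * z))
        \<and> (\<forall>x y. \<theta> (\<theta> x y) \<circ> \<theta> (x * y) = \<theta> y))"

definition idempotent_solution :: "('a::semigroup_mult \<times> 'a \<Rightarrow> 'a \<times> 'a) \<Rightarrow> bool" where
  "idempotent_solution s \<longleftrightarrow> pentagon_solution s \<and> s \<circ> s = s"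

text \<open>The set of idempotents is not a type, so a homomorphism into it is a multiplicative
  unit-preserving self-map of the monoid whose range consists of idempotents.\<close>

definition idempotent_hom_to_idempotents :: "('a::monoid_mult \<Rightarrow> 'a) \<Rightarrow> bool" where
  "idempotent_hom_to_idempotents \<mu> \<longleftrightarrow>
     range \<mu> \<subseteq> idempotents \<and> \<mu> 1 = 1 \<and> (\<forall>x y. \<mu> (x * y) = \<mu> x * \<mu> y) \<and> \<mu> \<circ> \<mu> = \<mu>"

text \<open>A family of maps indexed by the range of \<open>\<mu>\<close> is a total function \<open>\<theta>\<close> whose values
  outside that range are unconstrained and unused.\<close>

definition construction_data :: "('a::monoid_mult \<Rightarrow> 'a) \<Rightarrow> ('a \<Rightarrow> 'a \<Rightarrow> 'a) \<Rightarrow> bool" where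
  "construction_data \<mu> \<theta> \<longleftrightarrow>
     idempotent_hom_to_idempotents \<mu>
     \<and> (\<forall>x. x * \<mu> x = x)
     \<and> \<theta> 1 = \<mu>
     \<and> (\<forall>e \<in> range \<mu>.
          (\<forall>x y. \<theta> e (x * y) = \<theta> e x * \<theta> (\<mu> (e * x)) y)
        \<and> (\<forall>f \<in> range \<mu>. \<theta> e = \<theta> e \<circ> \<theta> (e * f))
        \<and> (\<forall>x. \<theta> (e * \<mu> x) (\<theta> e x) = \<theta> e x))"

definition constructed_map :: "('a::monoid_mult \<Rightarrow> 'a) \<Rightarrow> ('a \<Rightarrow> 'a \<Rightarrow> 'a) \<Rightarrow> 'a \<times> 'a \<Rightarrow> 'a \<times> 'a" where
  "constructed_map \<mu> \<theta> = (\<lambda>(x, y). (x * y, \<theta> (\<mu> x) y))"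

end

theory Submission
  imports Defs
begin

text \<open>
  Written out for the maps \<open>\<theta>\<^sub>x\<close>, idempotency of a pentagon solution adds the two laws
  \<open>xy \<theta>\<^sub>x(y) = xy\<close> and \<open>\<theta>\<^bsub>xy\<^esub>(\<theta>\<^sub>x(y)) = \<theta>\<^sub>x(y)\<close> to the two pentagon laws.

  From construction data to a solution, the pentagon laws and the second idempotency law are
  conditions (i)--(iii) once it is known that \<open>\<mu>\<theta>\<^sub>e = \<mu>\<close>, which is (ii) at the identity. Only
  \<open>xy \<theta>\<^sub>x(y) = xy\<close> is less direct. Condition (i) at the identity shows \<open>g \<theta>\<^sub>g(z) = g \<mu>(z)\<close> for
  \<open>g\<close> in the image of \<open>\<mu>\<close>. For \<open>g = \<mu>(xy)\<close>, the element \<open>z = \<theta>\<^bsub>\<mu>(x)\<^esub>(y)\<close> is a fixed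
  point of \<open>\<theta>\<^sub>g\<close> with \<open>\<mu>(z) = \<mu>(y)\<close>, so \<open>gz = g\<close>, and \<open>g\<close> is a right identity for \<open>xy\<close>.

  Conversely, the data of an idempotent solution are \<open>\<mu> = \<theta>\<^sub>1\<close> and the given \<open>\<theta>\<close>. The key facts
  are \<open>\<theta>\<^bsub>\<mu>(x)\<^esub> = \<theta>\<^sub>x\<close>, so that the family is determined by its values on the image of \<open>\<mu>\<close>, and
  \<open>\<mu>\<theta>\<^sub>x = \<mu>\<close>. Multiplicativity of \<open>\<mu>\<close> uses that idempotents are central: the pentagon law
  gives only the twisted rule \<open>\<mu>(yz) = \<mu>(y) \<theta>\<^sub>y(z)\<close>, whose right side depends on \<open>y\<close> only through
  \<open>\<mu>(y)\<close>, so \<open>\<mu>(yz) = \<mu>(\<mu>(y)z)\<close>; commuting the central idempotent \<open>\<mu>(y)\<close> past \<open>z\<close> allows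
  \<open>z\<close> to be replaced by \<open>\<mu>(z)\<close> in the same way, and \<open>\<mu>\<close> fixes the product \<open>\<mu>(y)\<mu>(z)\<close>.
\<close>

section \<open>Idempotent solutions by equations\<close>

lemma idempotent_solution_iff:
  fixes s :: "'a::semigroup_mult \<times> 'a \<Rightarrow> 'a \<times> 'a"
  shows "idempotent_solution s \<longleftrightarrow>
    (\<exists>\<theta>. s = (\<lambda>(x, y). (x * y, \<theta> x y))
      \<and> (\<forall>x y z. \<theta> x y * \<theta> (x * y) z = \<theta> x (y * z))
      \<and> (\<forall>x y z. \<theta> (\<theta> x y) (\<theta> (x * y) z) = \<theta> y z)
      \<and> (\<forall>x y. x * y * \<theta> x y = x * y)
      \<and> (\<forall>x y. \<theta> (x * y) (\<theta> x y) = \<theta> x y))"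
  (is "_ \<longleftrightarrow> (\<exists>\<theta>. ?P \<theta>)")
proof
  assume s: "idempotent_solution s"
  then obtain \<theta> where \<theta>: "\<And>x y. s (x, y) = (x * y, \<theta> x y)"
    "\<And>x y z. \<theta> x y * \<theta> (x * y) z = \<theta> x (y * z)"
    "\<And>x y. \<theta> (\<theta> x y) \<circ> \<theta> (x * y) = \<theta> y"
    unfolding idempotent_solution_def pentagon_solution_def by blast
  have "s (s (x, y)) = s (x, y)" for x y
    using s unfolding idempotent_solution_def by (metis comp_apply)
  then have "x * y * \<theta> x y = x * y \<and> \<theta> (x * y) (\<theta> x y) = \<theta> x y" for x y
    by (simp add: \<theta>(1))
  moreover have "\<theta> (\<theta> x y) (\<theta> (x * y) z) = \<theta> y z" for x y z
    using \<theta>(3) by (metis comp_apply)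
  moreover have "s = (\<lambda>(x, y). (x * y, \<theta> x y))"
    using \<theta>(1) by auto
  ultimately have "?P \<theta>"
    using \<theta>(2) by blast
  then show "\<exists>\<theta>. ?P \<theta>" by blast
next
  assume "\<exists>\<theta>. ?P \<theta>"
  then obtain \<theta> where "?P \<theta>" by blast
  then show "idempotent_solution s"
    unfolding idempotent_solution_def pentagon_solution_def
    by (auto intro!: exI[of _ \<theta>] simp: fun_eq_iff)
qed

section \<open>From construction data to idempotent solutions\<close>

lemma constructed_map_idempotent_solution:
  fixes \<mu> :: "'a::monoid_mult \<Rightarrow> 'a"
  assumes central: "(idempotents :: 'a set) \<subseteq> center"
    and data: "construction_data \<mu> \<theta>"
  shows "idempotent_solution (constructed_map \<mu> \<theta>)"
proof -
  have idem: "\<mu> x * \<mu> x = \<mu> x" and one: "\<mu> 1 = 1" and mult: "\<mu> (x * y) = \<mu> x * \<mu> y"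
    and proj: "\<mu> (\<mu> x) = \<mu> x" for x y
    using data
    unfolding construction_data_def idempotent_hom_to_idempotents_def idempotents_def
    by (auto simp: fun_eq_iff)
  have right_id: "x * \<mu> x = x" and theta_one: "\<theta> 1 = \<mu>" for x
    using data unfolding construction_data_def by auto
  have i: "\<theta> (\<mu> x) (y * z) = \<theta> (\<mu> x) y * \<theta> (\<mu> x * \<mu> y) z"
    and ii: "\<theta> (\<mu> x) (\<theta> (\<mu> x * \<mu> y) z) = \<theta> (\<mu> x) z"
    and iii: "\<theta> (\<mu> x * \<mu> y) (\<theta> (\<mu> x) y) = \<theta> (\<mu> x) y" for x y z
    using data unfolding construction_data_def by (auto simp: fun_eq_iff mult proj)
  have comm: "\<mu> x * y = y * \<mu> x" for x y
    using central idem[of x] unfolding idempotents_def center_def by blast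

  have mu_theta: "\<mu> (\<theta> (\<mu> x) y) = \<mu> y" for x y
    using ii[of 1 x y] by (simp add: one theta_one)
  have absorb: "\<mu> x * \<theta> (\<mu> x) y = \<mu> x * \<mu> y" for x y
    using i[of 1 x y] by (simp add: one theta_one mult)
  have "x * y * \<theta> (\<mu> x) y = x * y" for x y
  proof -
    let ?g = "\<mu> (x * y)" and ?z = "\<theta> (\<mu> x) y"
    have "?g * ?z = ?g * \<theta> ?g ?z"
      by (simp add: iii mult)
    also have "\<dots> = ?g * \<mu> y"
      by (simp add: absorb mu_theta)
    also have "\<dots> = ?g"
      by (simp add: mult mult.assoc idem)
    finally have "?g * ?z = ?g" .
    then have "x * y * ?g * ?z = x * y * ?g"
      by (simp only: mult.assoc)
    then show ?thesis by (simp only: right_id)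
  qed
  moreover have "\<theta> (\<mu> (\<theta> (\<mu> x) y)) (\<theta> (\<mu> (x * y)) z) = \<theta> (\<mu> y) z" for x y z
    using ii[of y x z] by (simp add: mu_theta mult comm[of x "\<mu> y"])
  moreover have "\<theta> (\<mu> x) y * \<theta> (\<mu> (x * y)) z = \<theta> (\<mu> x) (y * z)" for x y z
    by (simp add: i mult)
  moreover have "\<theta> (\<mu> (x * y)) (\<theta> (\<mu> x) y) = \<theta> (\<mu> x) y" for x y
    by (simp add: iii mult)
  ultimately show ?thesis
    unfolding idempotent_solution_iff constructed_map_def
    by (intro exI[of _ "\<lambda>x. \<theta> (\<mu> x)"]) blast
qed

section \<open>From idempotent solutions to construction data\<close>

locale idempotent_pentagon_maps =
  fixes \<theta> :: "'a::monoid_mult \<Rightarrow> 'a \<Rightarrow> 'a"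
  assumes theta_mult: "\<theta> x y * \<theta> (x * y) z = \<theta> x (y * z)"
    and theta_theta: "\<theta> (\<theta> x y) (\<theta> (x * y) z) = \<theta> y z"
    and mult_theta: "x * y * \<theta> x y = x * y"
    and theta_fix: "\<theta> (x * y) (\<theta> x y) = \<theta> x y"
begin

lemma mu_one: "\<theta> 1 1 = 1"
  using mult_theta[of 1 1] by simp

lemma mu_right_identity: "y * \<theta> 1 y = y"
  using mult_theta[of 1 y] by simp

lemma theta_mu_self: "\<theta> y (\<theta> 1 y) = \<theta> 1 y"
  using theta_fix[of 1 y] by simp

lemma mu_mult_twisted: "\<theta> 1 (y * z) = \<theta> 1 y * \<theta> y z"
  using theta_mult[of 1 y z] by simp

lemma mu_mu: "\<theta> 1 (\<theta> 1 y) = \<theta> 1 y"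
  using theta_theta[of 1 1 y] by (simp add: mu_one)

text \<open>Since \<open>y \<mu>(y) = y\<close>, the twisted multiplicativity of \<open>\<mu>\<close> on this product has
  \<open>\<theta>\<^sub>y(\<mu>(y)) = \<mu>(y)\<close> as its second factor.\<close>

lemma mu_idempotent: "\<theta> 1 y * \<theta> 1 y = \<theta> 1 y"
  using mu_mult_twisted[of y "\<theta> 1 y"] by (simp add: mu_right_identity theta_mu_self)

text \<open>Both maps equal \<open>\<theta>\<^bsub>\<mu>(y)\<^esub>\<theta>\<^sub>y\<close>, by the second pentagon law for the pairs \<open>(1, y)\<close> and
  \<open>(y, \<mu>(y))\<close>.\<close>

lemma theta_mu: "\<theta> (\<theta> 1 y) = \<theta> y"
proof
  fix z
  have "\<theta> (\<theta> 1 y) (\<theta> y z) = \<theta> y z"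
    using theta_theta[of 1 y z] by simp
  moreover have "\<theta> (\<theta> 1 y) (\<theta> y z) = \<theta> (\<theta> 1 y) z"
    using theta_theta[of y "\<theta> 1 y" z] by (simp add: mu_right_identity theta_mu_self)
  ultimately show "\<theta> (\<theta> 1 y) z = \<theta> y z" by simp
qed

text \<open>With \<open>u = \<theta>\<^sub>x(1)\<close>, the second pentagon law reads \<open>\<theta>\<^sub>u\<theta>\<^sub>x = \<mu>\<close>, so it is enough that
  \<open>\<theta>\<^sub>u = \<mu>\<close>. The element \<open>u\<close> is idempotent and satisfies \<open>\<theta>\<^sub>u(u) = \<theta>\<^sub>u(1) = 1\<close>, and then the
  same law for \<open>(u, u)\<close> and \<open>(u, 1)\<close> evaluates \<open>\<mu>\<theta>\<^sub>u\<close> both as \<open>\<theta>\<^sub>u\<close> and as \<open>\<mu>\<close>.\<close>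

lemma mu_theta: "\<theta> 1 (\<theta> x y) = \<theta> 1 y"
proof -
  define u where "u = \<theta> x 1"
  have u_theta: "\<theta> u (\<theta> x z) = \<theta> 1 z" for z
    using theta_theta[of x 1 z] by (simp add: u_def)
  have "\<theta> x u = u"
    using theta_fix[of x 1] by (simp add: u_def)
  moreover have "x * u = x"
    using mult_theta[of x 1] by (simp add: u_def)
  ultimately have uu: "u * u = u"
    using theta_mult[of x 1 u] by (simp add: u_def)
  have theta_uu: "\<theta> u u = 1"
    using u_theta[of 1] by (simp add: u_def mu_one)
  then have theta_u1: "\<theta> u 1 = 1"
    using theta_fix[of u u] by (simp add: uu)
  have "\<theta> u z = \<theta> 1 z" for z
    using theta_theta[of u u z] theta_theta[of u 1 z] by (simp add: uu theta_uu theta_u1)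
  then show ?thesis
    using u_theta by simp
qed

lemma theta_absorb: "\<theta> y (\<theta> (x * y) z) = \<theta> y z"
  using theta_theta[of x y z] theta_mu[of "\<theta> x y"] theta_mu[of y] by (simp add: mu_theta)

lemma mu_mult_left: "\<theta> 1 (\<theta> 1 y * z) = \<theta> 1 (y * z)"
  by (simp add: mu_mult_twisted mu_mu theta_mu)

context
  assumes central: "(idempotents :: 'a set) \<subseteq> center"
begin

lemma mu_commute: "\<theta> 1 x * y = y * \<theta> 1 x"
  using central mu_idempotent[of x] unfolding idempotents_def center_def by blast

text \<open>For \<open>e, f\<close> in the image of \<open>\<mu>\<close>, the factor \<open>f\<close> is absorbed by \<open>\<mu>(ef) = \<mu>(fe)\<close>, so
  \<open>\<mu>(ef) = f \<mu>(ef) = f e \<theta>\<^sub>e(f)\<close>. The law \<open>e f \<theta>\<^sub>e(f) = e f\<close> evaluates this.\<close>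

lemma mu_mult_image: "\<theta> 1 (\<theta> 1 x * \<theta> 1 y) = \<theta> 1 x * \<theta> 1 y"
proof -
  let ?e = "\<theta> 1 x" and ?f = "\<theta> 1 y"
  have "\<theta> 1 (?e * ?f) = ?f * \<theta> ?f ?e"
    by (simp only: mu_commute[of x ?f] mu_mult_twisted[of ?f ?e] mu_mu)
  then have "\<theta> 1 (?e * ?f) = ?f * \<theta> 1 (?e * ?f)"
    by (metis mult.assoc mu_idempotent)
  also have "\<dots> = ?f * (?e * \<theta> ?e ?f)"
    by (simp only: mu_mult_twisted[of ?e ?f] mu_mu)
  also have "\<dots> = ?e * ?f * \<theta> ?e ?f"
    by (simp only: mult.assoc[symmetric] mu_commute[of y ?e])
  finally show ?thesis by (simp only: mult_theta)
qed

lemma mu_mult: "\<theta> 1 (x * y) = \<theta> 1 x * \<theta> 1 y"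
proof -
  have "\<theta> 1 (x * y) = \<theta> 1 (y * \<theta> 1 x)"
    by (simp add: mu_mult_left[symmetric, of x y] mu_commute)
  also have "\<dots> = \<theta> 1 (\<theta> 1 y * \<theta> 1 x)"
    by (simp add: mu_mult_left)
  finally show ?thesis
    by (simp add: mu_mult_image mu_commute[of y])
qed

lemma construction_data_mu_theta: "construction_data (\<theta> 1) \<theta>"
proof -
  have theta_index: "\<theta> (\<theta> 1 x * \<theta> 1 y) = \<theta> (x * y)" for x y
    by (simp add: mu_mult[symmetric] theta_mu)
  have "\<theta> (\<theta> 1 x) (y * z) = \<theta> (\<theta> 1 x) y * \<theta> (\<theta> 1 (\<theta> 1 x * y)) z" for x y z
    by (simp add: mu_mult_left theta_mu theta_mult)
  moreover have "\<theta> (\<theta> 1 x) = \<theta> (\<theta> 1 x) \<circ> \<theta> (\<theta> 1 x * \<theta> 1 y)" for x y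
    by (simp add: fun_eq_iff mu_commute[of x] theta_absorb)
  moreover have "\<theta> (\<theta> 1 x * \<theta> 1 y) (\<theta> (\<theta> 1 x) y) = \<theta> (\<theta> 1 x) y" for x y
    by (simp add: theta_index theta_mu theta_fix)
  moreover have "idempotent_hom_to_idempotents (\<theta> 1)"
    unfolding idempotent_hom_to_idempotents_def idempotents_def
    by (auto simp: mu_idempotent mu_one mu_mult mu_mu)
  ultimately show ?thesis
    unfolding construction_data_def by (auto simp only: mu_right_identity)
qed

end

end

lemma idempotent_solution_constructed:
  fixes s :: "'a::monoid_mult \<times> 'a \<Rightarrow> 'a \<times> 'a"
  assumes central: "(idempotents :: 'a set) \<subseteq> center"
    and s: "idempotent_solution s"
  shows "\<exists>\<mu> \<theta>. construction_data \<mu> \<theta> \<and> s = constructed_map \<mu> \<theta>"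
proof -
  from s obtain \<theta> where s_eq: "s = (\<lambda>(x, y). (x * y, \<theta> x y))"
    and \<theta>: "idempotent_pentagon_maps \<theta>"
    unfolding idempotent_solution_iff idempotent_pentagon_maps_def by blast
  interpret idempotent_pentagon_maps \<theta> by (rule \<theta>)
  have "s = constructed_map (\<theta> 1) \<theta>"
    by (simp add: s_eq constructed_map_def theta_mu)
  then show ?thesis
    using construction_data_mu_theta[OF central] by blast
qed

theorem theorem19:
  assumes "(idempotents :: 'a::monoid_mult set) \<subseteq> center"
  shows "(\<forall>(\<mu> :: 'a \<Rightarrow> 'a) \<theta>. construction_data \<mu> \<theta> \<longrightarrow> idempotent_solution (constructed_map \<mu> \<theta>))
    \<and> (\<forall>s :: 'a \<times> 'a \<Rightarrow> 'a \<times> 'a. idempotent_solution s \<longrightarrow>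
          (\<exists>\<mu> \<theta>. construction_data \<mu> \<theta> \<and> s = constructed_map \<mu> \<theta>))"
  using constructed_map_idempotent_solution[OF assms]
    idempotent_solution_constructed[OF assms] by blast

end
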